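(* Let $\mathbf{L}=\langle L,\leq\rangle$ be a complete lattice, $S$ an $L$-parameterization, and $S'$ the monoid generated by $S$. Then for any $M\subseteq L$ and any $a\in L$, $$C_M(a)=\bigwedge\{h(m);\ m\in M,\ \langle f,h\rangle\in S',\ a\leq h(m)\}.$$
   Context: An isotone Galois connection in $\mathbf{L}$ is a pair $\langle f,h\rangle$ of maps $L\to L$ with $f(a)\leq b$ iff $a\leq h(b)$; composition $\langle f_1,h_1\rangle\circ\langle f_2,h_2\rangle=\langle f_1f_2,h_2h_1\rangle$. An $L$-parameterization is a set $S$ of isotone Galois connections containing $\langle\mathrm{id},\mathrm{id}\rangle$. $S'$ is the set of all finite compositions of elements of $S$. For $a,b\in L$, $M\models a\Rightarrow b$ means: for all $m\in M$ and $\langle f,h\rangle\in S'$, $f(a)\leq m$ implies $f(b)\leq m$. $C_M(a)=\bigvee\{b\in L;\ M\models a\Rightarrow b\}$. *)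

theory Defs
  imports Main
begin

definition isotone_galois_connection :: "('a::order \<Rightarrow> 'a) \<times> ('a \<Rightarrow> 'a) \<Rightarrow> bool" where
  "isotone_galois_connection = (\<lambda>(f, h). \<forall>a b. f a \<le> b \<longleftrightarrow> a \<le> h b)"

definition gc_comp ::
  "('a \<Rightarrow> 'a) \<times> ('a \<Rightarrow> 'a) \<Rightarrow> ('a \<Rightarrow> 'a) \<times> ('a \<Rightarrow> 'a) \<Rightarrow> ('a \<Rightarrow> 'a) \<times> ('a \<Rightarrow> 'a)" where
  "gc_comp = (\<lambda>(f1, h1) (f2, h2). (f1 \<circ> f2, h2 \<circ> h1))"

definition L_parameterization :: "(('a::order \<Rightarrow> 'a) \<times> ('a \<Rightarrow> 'a)) set \<Rightarrow> bool" where
  "L_parameterization S \<longleftrightarrow> (\<forall>p\<in>S. isotone_galois_connection p) \<and> (id, id) \<in> S"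

inductive_set generated_monoid ::
  "(('a \<Rightarrow> 'a) \<times> ('a \<Rightarrow> 'a)) set \<Rightarrow> (('a \<Rightarrow> 'a) \<times> ('a \<Rightarrow> 'a)) set"
  for S :: "(('a \<Rightarrow> 'a) \<times> ('a \<Rightarrow> 'a)) set" where
  unit: "(id, id) \<in> generated_monoid S"
| incl: "p \<in> S \<Longrightarrow> p \<in> generated_monoid S"
| comp: "p \<in> generated_monoid S \<Longrightarrow> q \<in> generated_monoid S \<Longrightarrow> gc_comp p q \<in> generated_monoid S"

definition models_impl ::
  "(('a::order \<Rightarrow> 'a) \<times> ('a \<Rightarrow> 'a)) set \<Rightarrow> 'a set \<Rightarrow> 'a \<Rightarrow> 'a \<Rightarrow> bool" where
  "models_impl S M a b \<longleftrightarrow>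
    (\<forall>m\<in>M. \<forall>(f, h)\<in>generated_monoid S. f a \<le> m \<longrightarrow> f b \<le> m)"

definition semantic_closure ::
  "(('a::complete_lattice \<Rightarrow> 'a) \<times> ('a \<Rightarrow> 'a)) set \<Rightarrow> 'a set \<Rightarrow> 'a \<Rightarrow> 'a" where
  "semantic_closure S M a = Sup {b. models_impl S M a b}"

end

theory Submission
  imports Defs
begin

text \<open>Adjunction turns \<open>f a \<le> m\<close> into \<open>a \<le> h m\<close>, so
  \<open>a\<close> entails \<open>b\<close> exactly when \<open>b\<close> lies below every
  \<open>h m\<close> that lies above \<open>a\<close>. The elements entailed by \<open>a\<close>
  thus form the principal down-set of the infimum in question
  (\<open>models_impl_iff_le_Inf\<close>), and its supremum is its top element.\<close>

lemma isotone_galois_connection_gc_comp: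
  assumes "isotone_galois_connection p" "isotone_galois_connection q"
  shows "isotone_galois_connection (gc_comp p q)"
  using assms by (auto simp: isotone_galois_connection_def gc_comp_def split: prod.splits)

text \<open>Entailment quantifies over the whole monoid, while \<open>L_parameterization\<close>
  constrains only the generators; induction carries the adjunction over.\<close>

lemma isotone_galois_connection_generated_monoid:
  assumes "\<And>p. p \<in> S \<Longrightarrow> isotone_galois_connection p" and "p \<in> generated_monoid S"
  shows "isotone_galois_connection p"
  using assms(2)
proof induction
  case unit
  show ?case by (simp add: isotone_galois_connection_def)
next
  case (incl p)
  then show ?case by (rule assms(1))
next
  case (comp p q)
  then show ?case by (simp add: isotone_galois_connection_gc_comp)
qed

lemma models_impl_iff_le_Inf:
  fixes S :: "(('a::complete_lattice \<Rightarrow> 'a) \<times> ('a \<Rightarrow> 'a)) set"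
  assumes "L_parameterization S"
  shows "models_impl S M a b \<longleftrightarrow>
    b \<le> Inf {h m | f h m. m \<in> M \<and> (f, h) \<in> generated_monoid S \<and> a \<le> h m}"
proof -
  have adj: "f x \<le> y \<longleftrightarrow> x \<le> h y" if "(f, h) \<in> generated_monoid S" for f h x y
    using isotone_galois_connection_generated_monoid[OF _ that] assms
    by (auto simp: L_parameterization_def isotone_galois_connection_def)
  have "models_impl S M a b \<longleftrightarrow>
    (\<forall>m\<in>M. \<forall>(f, h)\<in>generated_monoid S. a \<le> h m \<longrightarrow> b \<le> h m)"
    \<comment> \<open>The same \<open>m\<close> bounds both \<open>f a\<close> and
      \<open>f b\<close>, so one \<open>h m\<close> replaces both bounds.\<close>
    unfolding models_impl_def using adj by fastforce
  then show ?thesis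
    by (auto simp: le_Inf_iff)
qed

theorem theorem29:
  fixes S :: "(('a::complete_lattice \<Rightarrow> 'a) \<times> ('a \<Rightarrow> 'a)) set"
    and M :: "'a set" and a :: 'a
  assumes "L_parameterization S"
  shows "semantic_closure S M a =
    Inf {h m | f h m. m \<in> M \<and> (f, h) \<in> generated_monoid S \<and> a \<le> h m}"
  unfolding semantic_closure_def models_impl_iff_le_Inf[OF assms]
  \<comment> \<open>The set is now all \<open>b\<close> below the infimum, which itself belongs to
    it.\<close>
  by (rule Sup_eqI) auto

end
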